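(* The calculus $\mathbf{ACT}_\omega$ is strongly complete w.r.t. SCL-models with non-standard $\bot$: for any set of sequents $\mathcal{H}$ and sequent $\Pi\to C$, if $\Pi\to C$ is true in every SCL-model with non-standard $\bot$ validating all of $\mathcal{H}$, then $\Pi\to C$ is derivable in $\mathbf{ACT}_\omega$ from $\mathcal{H}$.
   Context: Formulae are built from variables and constants $\top,\bot,\mathbf{1}$ using $\backslash,/,\cdot,\wedge,\vee$ and Kleene iteration ${}^*$. Sequents $A_1,\dots,A_n\to B$ may have empty antecedents ($n\ge0$), including hypotheses. $\mathbf{MALC}$ (full Lambek calculus) has axioms $A\to A$, $\Gamma,\bot,\Delta\to C$, $\Pi\to\top$, $\to\mathbf{1}$, rule from $\Gamma,\Delta\to C$ infer $\Gamma,\mathbf{1},\Delta\to C$, the usual rules for $\cdot,\backslash,/,\wedge,\vee$ (no non-emptiness restriction on $\backslash$R, $/$R), and Cut. $\mathbf{ACT}_\omega$ adds: from $\Gamma,A^n,\Delta\to C$ for all $n\ge0$ infer $\Gamma,A^*,\Delta\to C$; and for $n\ge0$ from $\Pi_i\to A$ ($i=1..n$) infer $\Pi_1,\dots,\Pi_n\to A^*$. SCL-models: fix $\Sigma$ and $L\subseteq\Sigma^*$; $M^{\rhd}=\{(x,y)\in\Sigma^*\times\Sigma^*\mid\forall w\in M\; xwy\in L\}$, $C^{\lhd}=\{v\in\Sigma^*\mid\forall(x,y)\in C\; xvy\in L\}$. Closed languages $M=M^{\rhd\lhd}$ form an infinitary action lattice with order $\subseteq$, meet $\cap$, join $(M_1\cup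 M_2)^{\rhd\lhd}$, product $(M_1\cdot M_2)^{\rhd\lhd}$, divisions as for languages ($M_1\backslash M_2=\{u\mid\forall v\in M_1\; vu\in M_2\}$, symmetric $/$), iteration $(M^* )^{\rhd\lhd}$, $\top=\Sigma^*$, $\mathbf{1}=\{\varepsilon\}^{\rhd\lhd}$, $\bot=\varnothing^{\rhd\lhd}$. A closed $Z$ is a local zero if for all closed $M\supseteq Z$, $(M\cdot Z)^{\rhd\lhd}=(Z\cdot M)^{\rhd\lhd}=Z$. An SCL-model with non-standard $\bot$ is an interpretation in the upper cone $\{M \text{ closed}\mid Z\subseteq M\}$, where $Z$ is a local zero with $\varepsilon\in Z$, taking $Z$ as $\bot$ and commuting with the operations. A sequent $A_1,\dots,A_n\to B$ is true if the closed product of the interpretations of the $A_i$ is contained in that of $B$; $\to B$ is true iff $\varepsilon$ belongs to the interpretation of $B$.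
   Formalization: The condition ε ∈ Z on the local zero is replaced by Z ⊆ {ε}^{▷◁} (so that 1 lies in the upper cone); with ε ∈ Z one gets Z = Σ*, every sequent is true in every model, and completeness fails, e.g. for → ⊥ with no hypotheses. *)

theory Defs
  imports Main "HOL-Library.Countable"
begin

section \<open>Infinitary action logic\<close>

datatype 'v fm =
    Var 'v
  | Top
  | Bot
  | One
  | LDiv "'v fm" "'v fm"  (infixr "\<rightharpoonup>" 65)
  | RDiv "'v fm" "'v fm"  (infixl "\<leftharpoonup>" 65)
  | Prod "'v fm" "'v fm"  (infixl "\<odot>" 70)
  | Meet "'v fm" "'v fm"  (infixl "\<sqinter>\<^sub>f" 60)
  | Join "'v fm" "'v fm"  (infixl "\<squnion>\<^sub>f" 60)
  | Star "'v fm"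

text \<open>\<open>A \<rightharpoonup> B\<close> is the left division (denominator \<open>A\<close> on the left), \<open>B \<leftharpoonup> A\<close> the right one.
  A sequent \<open>(\<Gamma>, C)\<close> stands for \<open>\<Gamma> \<rightarrow> C\<close>.\<close>

type_synonym 'v sequent = "'v fm list \<times> 'v fm"

inductive derivable :: "'v sequent set \<Rightarrow> 'v fm list \<Rightarrow> 'v fm \<Rightarrow> bool"
  for H :: "'v sequent set"
where
  hyp: "(\<Gamma>, C) \<in> H \<Longrightarrow> derivable H \<Gamma> C"
| ax: "derivable H [A] A"
| botL: "derivable H (\<Gamma> @ [Bot] @ \<Delta>) C"
| topR: "derivable H \<Pi> Top"
| oneR: "derivable H [] One"
| oneL: "derivable H (\<Gamma> @ \<Delta>) C \<Longrightarrow> derivable H (\<Gamma> @ [One] @ \<Delta>) C"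
| ldivL: "derivable H \<Pi> A \<Longrightarrow> derivable H (\<Gamma> @ [B] @ \<Delta>) C \<Longrightarrow>
    derivable H (\<Gamma> @ \<Pi> @ [A \<rightharpoonup> B] @ \<Delta>) C"
| ldivR: "derivable H ([A] @ \<Pi>) B \<Longrightarrow> derivable H \<Pi> (A \<rightharpoonup> B)"
| rdivL: "derivable H \<Pi> A \<Longrightarrow> derivable H (\<Gamma> @ [B] @ \<Delta>) C \<Longrightarrow>
    derivable H (\<Gamma> @ [B \<leftharpoonup> A] @ \<Pi> @ \<Delta>) C"
| rdivR: "derivable H (\<Pi> @ [A]) B \<Longrightarrow> derivable H \<Pi> (B \<leftharpoonup> A)"
| prodL: "derivable H (\<Gamma> @ [A, B] @ \<Delta>) C \<Longrightarrow> derivable H (\<Gamma> @ [A \<odot> B] @ \<Delta>) C"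
| prodR: "derivable H \<Gamma> A \<Longrightarrow> derivable H \<Delta> B \<Longrightarrow> derivable H (\<Gamma> @ \<Delta>) (A \<odot> B)"
| meetL1: "derivable H (\<Gamma> @ [A] @ \<Delta>) C \<Longrightarrow> derivable H (\<Gamma> @ [A \<sqinter>\<^sub>f B] @ \<Delta>) C"
| meetL2: "derivable H (\<Gamma> @ [B] @ \<Delta>) C \<Longrightarrow> derivable H (\<Gamma> @ [A \<sqinter>\<^sub>f B] @ \<Delta>) C"
| meetR: "derivable H \<Pi> A \<Longrightarrow> derivable H \<Pi> B \<Longrightarrow> derivable H \<Pi> (A \<sqinter>\<^sub>f B)"
| joinL: "derivable H (\<Gamma> @ [A] @ \<Delta>) C \<Longrightarrow> derivable H (\<Gamma> @ [B] @ \<Delta>) C \<Longrightarrow>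
    derivable H (\<Gamma> @ [A \<squnion>\<^sub>f B] @ \<Delta>) C"
| joinR1: "derivable H \<Pi> A \<Longrightarrow> derivable H \<Pi> (A \<squnion>\<^sub>f B)"
| joinR2: "derivable H \<Pi> B \<Longrightarrow> derivable H \<Pi> (A \<squnion>\<^sub>f B)"
| starL: "(\<forall>n. derivable H (\<Gamma> @ replicate n A @ \<Delta>) C) \<Longrightarrow> derivable H (\<Gamma> @ [Star A] @ \<Delta>) C"
| starR: "(\<forall>\<Pi>\<in>set Ps. derivable H \<Pi> A) \<Longrightarrow> derivable H (concat Ps) (Star A)"
| cut: "derivable H \<Pi> A \<Longrightarrow> derivable H (\<Gamma> @ [A] @ \<Delta>) C \<Longrightarrow> derivable H (\<Gamma> @ \<Pi> @ \<Delta>) C"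


section \<open>Syntactic concept lattices\<close>

type_synonym 'a lang = "'a list set"

definition rhd :: "'a set \<Rightarrow> 'a lang \<Rightarrow> 'a lang \<Rightarrow> ('a list \<times> 'a list) set" where
  "rhd \<Sigma> L M = {(x, y) \<in> lists \<Sigma> \<times> lists \<Sigma>. \<forall>w\<in>M. x @ w @ y \<in> L}"

definition lhd :: "'a set \<Rightarrow> 'a lang \<Rightarrow> ('a list \<times> 'a list) set \<Rightarrow> 'a lang" where
  "lhd \<Sigma> L C = {v \<in> lists \<Sigma>. \<forall>(x, y)\<in>C. x @ v @ y \<in> L}"

definition cl :: "'a set \<Rightarrow> 'a lang \<Rightarrow> 'a lang \<Rightarrow> 'a lang" where
  "cl \<Sigma> L M = lhd \<Sigma> L (rhd \<Sigma> L M)"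

text \<open>Every closed set is a language over \<open>\<Sigma>\<close>, because the values of \<open>lhd\<close> are.\<close>

definition closed_lang :: "'a set \<Rightarrow> 'a lang \<Rightarrow> 'a lang \<Rightarrow> bool" where
  "closed_lang \<Sigma> L M \<longleftrightarrow> M = cl \<Sigma> L M"

definition conc :: "'a lang \<Rightarrow> 'a lang \<Rightarrow> 'a lang" where
  "conc M N = {u @ v | u v. u \<in> M \<and> v \<in> N}"

definition lang_star :: "'a lang \<Rightarrow> 'a lang" where
  "lang_star M = {concat ws | ws. ws \<in> lists M}"

definition lang_ldiv :: "'a set \<Rightarrow> 'a lang \<Rightarrow> 'a lang \<Rightarrow> 'a lang" where
  "lang_ldiv \<Sigma> M N = {u \<in> lists \<Sigma>. \<forall>v\<in>M. v @ u \<in> N}"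

definition lang_rdiv :: "'a set \<Rightarrow> 'a lang \<Rightarrow> 'a lang \<Rightarrow> 'a lang" where
  "lang_rdiv \<Sigma> N M = {u \<in> lists \<Sigma>. \<forall>v\<in>M. u @ v \<in> N}"

definition local_zero :: "'a set \<Rightarrow> 'a lang \<Rightarrow> 'a lang \<Rightarrow> bool" where
  "local_zero \<Sigma> L Z \<longleftrightarrow> closed_lang \<Sigma> L Z \<and>
     (\<forall>M. closed_lang \<Sigma> L M \<longrightarrow> Z \<subseteq> M \<longrightarrow>
        cl \<Sigma> L (conc M Z) = Z \<and> cl \<Sigma> L (conc Z M) = Z)"

definition upper_cone :: "'a set \<Rightarrow> 'a lang \<Rightarrow> 'a lang \<Rightarrow> 'a lang set" where
  "upper_cone \<Sigma> L Z = {M. closed_lang \<Sigma> L M \<and> Z \<subseteq> M}"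


section \<open>Models with non-standard bottom\<close>

primrec interp :: "'a set \<Rightarrow> 'a lang \<Rightarrow> 'a lang \<Rightarrow> ('v \<Rightarrow> 'a lang) \<Rightarrow> 'v fm \<Rightarrow> 'a lang" where
  "interp \<Sigma> L Z v (Var p) = v p"
| "interp \<Sigma> L Z v Top = lists \<Sigma>"
| "interp \<Sigma> L Z v Bot = Z"
| "interp \<Sigma> L Z v One = cl \<Sigma> L {[]}"
| "interp \<Sigma> L Z v (A \<rightharpoonup> B) = lang_ldiv \<Sigma> (interp \<Sigma> L Z v A) (interp \<Sigma> L Z v B)"
| "interp \<Sigma> L Z v (B \<leftharpoonup> A) = lang_rdiv \<Sigma> (interp \<Sigma> L Z v B) (interp \<Sigma> L Z v A)"
| "interp \<Sigma> L Z v (A \<odot> B) = cl \<Sigma> L (conc (interp \<Sigma> L Z v A) (interp \<Sigma> L Z v B))"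
| "interp \<Sigma> L Z v (A \<sqinter>\<^sub>f B) = interp \<Sigma> L Z v A \<inter> interp \<Sigma> L Z v B"
| "interp \<Sigma> L Z v (A \<squnion>\<^sub>f B) = cl \<Sigma> L (interp \<Sigma> L Z v A \<union> interp \<Sigma> L Z v B)"
| "interp \<Sigma> L Z v (Star A) = cl \<Sigma> L (lang_star (interp \<Sigma> L Z v A))"

text \<open>
  The unit \<open>cl \<Sigma> L {[]}\<close> has to lie in the upper cone of \<open>Z\<close>, for otherwise \<open>One\<close> could not be
  interpreted there and \<open>Bot \<rightarrow> One\<close> would fail; this is the condition \<open>Z \<subseteq> cl \<Sigma> L {[]}\<close>
  below. The condition \<open>[] \<in> Z\<close>, sometimes written in its place, is the reverse inclusion
  \<open>cl \<Sigma> L {[]} \<subseteq> Z\<close>. It forces \<open>Z = lists \<Sigma>\<close> (lemma \<open>local_zero_Nil_trivial\<close>), so that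
  every sequent would be true in every model.

  The alphabet is an arbitrary subset of the type of letters. With letters of type \<open>nat\<close> this
  gives all countable alphabets, finite ones included, up to renaming of letters. Completeness
  for this class of models implies completeness for models over alphabets of any cardinality.
\<close>

definition scl_model :: "'a set \<Rightarrow> 'a lang \<Rightarrow> 'a lang \<Rightarrow> ('v \<Rightarrow> 'a lang) \<Rightarrow> bool" where
  "scl_model \<Sigma> L Z v \<longleftrightarrow>
     L \<subseteq> lists \<Sigma> \<and> local_zero \<Sigma> L Z \<and> Z \<subseteq> cl \<Sigma> L {[]} \<and> (\<forall>p. v p \<in> upper_cone \<Sigma> L Z)"

fun true_seq :: "'a set \<Rightarrow> 'a lang \<Rightarrow> 'a lang \<Rightarrow> ('v \<Rightarrow> 'a lang) \<Rightarrow> 'v sequent \<Rightarrow> bool" where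
  "true_seq \<Sigma> L Z v ([], B) \<longleftrightarrow> [] \<in> interp \<Sigma> L Z v B"
| "true_seq \<Sigma> L Z v (A # \<Gamma>, B) \<longleftrightarrow>
     foldl (\<lambda>M D. cl \<Sigma> L (conc M (interp \<Sigma> L Z v D))) (interp \<Sigma> L Z v A) \<Gamma> \<subseteq> interp \<Sigma> L Z v B"


section \<open>Sanity checks\<close>

lemma cl_extensive: "M \<subseteq> lists \<Sigma> \<Longrightarrow> M \<subseteq> cl \<Sigma> L M"
  unfolding cl_def lhd_def rhd_def by blast

lemma rhd_antimono: "M \<subseteq> N \<Longrightarrow> rhd \<Sigma> L N \<subseteq> rhd \<Sigma> L M"
  unfolding rhd_def by blast

lemma lhd_antimono: "C \<subseteq> D \<Longrightarrow> lhd \<Sigma> L D \<subseteq> lhd \<Sigma> L C"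
  unfolding lhd_def by blast

lemma cl_mono: "M \<subseteq> N \<Longrightarrow> cl \<Sigma> L M \<subseteq> cl \<Sigma> L N"
  unfolding cl_def by (intro lhd_antimono rhd_antimono)

lemma cl_lists: "cl \<Sigma> L M \<subseteq> lists \<Sigma>"
  unfolding cl_def lhd_def by blast

lemma closed_langI: "M \<subseteq> lists \<Sigma> \<Longrightarrow> cl \<Sigma> L M \<subseteq> M \<Longrightarrow> closed_lang \<Sigma> L M"
  unfolding closed_lang_def by (intro equalityI cl_extensive)

lemma closed_cl: "closed_lang \<Sigma> L (cl \<Sigma> L M)"
proof (rule closed_langI[OF cl_lists])
  have "rhd \<Sigma> L M \<subseteq> rhd \<Sigma> L (cl \<Sigma> L M)"
    unfolding cl_def lhd_def rhd_def by blast
  then show "cl \<Sigma> L (cl \<Sigma> L M) \<subseteq> cl \<Sigma> L M"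
    unfolding cl_def[of \<Sigma> L M] cl_def[of \<Sigma> L "lhd \<Sigma> L (rhd \<Sigma> L M)"] by (rule lhd_antimono)
qed

lemma closed_subset: "closed_lang \<Sigma> L M \<Longrightarrow> M \<subseteq> lists \<Sigma>"
proof -
  assume "closed_lang \<Sigma> L M"
  then have "cl \<Sigma> L M = M" by (simp only: closed_lang_def)
  then show "M \<subseteq> lists \<Sigma>" using cl_lists[of \<Sigma> L M] by (simp only:)
qed

lemma closed_lists: "closed_lang \<Sigma> L (lists \<Sigma>)"
  by (rule closed_langI[OF subset_refl cl_lists])

lemma conc_lists: "M \<subseteq> lists \<Sigma> \<Longrightarrow> N \<subseteq> lists \<Sigma> \<Longrightarrow> conc M N \<subseteq> lists \<Sigma>"
proof -
  assume "M \<subseteq> lists \<Sigma>" "N \<subseteq> lists \<Sigma>"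
  then have "u @ v \<in> lists \<Sigma>" if "u \<in> M" "v \<in> N" for u v
    using that by (simp only: append_in_lists_conv subset_iff)
  then show "conc M N \<subseteq> lists \<Sigma>" unfolding conc_def by blast
qed

lemma lang_star_lists:
  assumes "M \<subseteq> lists \<Sigma>"
  shows "lang_star M \<subseteq> lists \<Sigma>"
proof -
  have "concat ws \<in> lists \<Sigma>" if "ws \<in> lists M" for ws
    using that
  proof (induction ws)
    case (Cons w ws)
    then show ?case using subsetD[OF assms, of w] by simp
  qed simp
  then show ?thesis unfolding lang_star_def by blast
qed

lemma local_zero_closed: "local_zero \<Sigma> L Z \<Longrightarrow> closed_lang \<Sigma> L Z"
  by (simp only: local_zero_def)

lemma local_zero_absorb:
  assumes "local_zero \<Sigma> L Z" "closed_lang \<Sigma> L M" "Z \<subseteq> M"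
  shows "cl \<Sigma> L (conc M Z) = Z" "cl \<Sigma> L (conc Z M) = Z"
  using assms by (simp_all add: local_zero_def)

lemma local_zero_Nil_trivial:
  assumes "local_zero \<Sigma> L Z" "[] \<in> Z"
  shows "Z = lists \<Sigma>"
proof
  have Z: "Z \<subseteq> lists \<Sigma>" by (rule closed_subset[OF local_zero_closed[OF assms(1)]])
  then have eq: "cl \<Sigma> L (conc (lists \<Sigma>) Z) = Z"
    by (rule local_zero_absorb(1)[OF assms(1) closed_lists])
  have "lists \<Sigma> \<subseteq> conc (lists \<Sigma>) Z"
  proof
    fix w assume "w \<in> lists \<Sigma>"
    then have "w @ [] \<in> conc (lists \<Sigma>) Z" using assms(2) unfolding conc_def by blast
    then show "w \<in> conc (lists \<Sigma>) Z" by simp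
  qed
  moreover have "conc (lists \<Sigma>) Z \<subseteq> lists \<Sigma>"
    using Z by (simp add: conc_lists)
  ultimately show "lists \<Sigma> \<subseteq> Z"
    using cl_extensive[of "conc (lists \<Sigma>) Z" \<Sigma> L] eq by (metis order_trans)
  show "Z \<subseteq> lists \<Sigma>" by (fact Z)
qed

lemma closed_ldiv:
  assumes M: "M \<subseteq> lists \<Sigma>" and N: "closed_lang \<Sigma> L N"
  shows "closed_lang \<Sigma> L (lang_ldiv \<Sigma> M N)"
proof (rule closed_langI)
  show "cl \<Sigma> L (lang_ldiv \<Sigma> M N) \<subseteq> lang_ldiv \<Sigma> M N"
  proof
    fix u assume u: "u \<in> cl \<Sigma> L (lang_ldiv \<Sigma> M N)"
    have "v @ u \<in> N" if v: "v \<in> M" for v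
    proof -
      have "x @ (v @ u) @ y \<in> L" if xy: "(x, y) \<in> rhd \<Sigma> L N" for x y
      proof -
        have "(x @ v, y) \<in> rhd \<Sigma> L (lang_ldiv \<Sigma> M N)"
        proof -
          have "x @ (v @ w) @ y \<in> L" if "w \<in> lang_ldiv \<Sigma> M N" for w
            using xy v that unfolding rhd_def lang_ldiv_def by blast
          moreover have "v \<in> lists \<Sigma>" using v M by blast
          ultimately show ?thesis using xy by (simp add: rhd_def)
        qed
        then show ?thesis using u by (auto simp: cl_def lhd_def)
      qed
      then have "v @ u \<in> cl \<Sigma> L N"
        using u v M cl_lists[of \<Sigma> L] by (auto simp: cl_def lhd_def)
      then show ?thesis using N by (simp add: closed_lang_def)
    qed
    then show "u \<in> lang_ldiv \<Sigma> M N"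
      using u cl_lists[of \<Sigma> L] by (auto simp: lang_ldiv_def)
  qed
qed (auto simp: lang_ldiv_def)

lemma closed_rdiv:
  assumes M: "M \<subseteq> lists \<Sigma>" and N: "closed_lang \<Sigma> L N"
  shows "closed_lang \<Sigma> L (lang_rdiv \<Sigma> N M)"
proof (rule closed_langI)
  show "cl \<Sigma> L (lang_rdiv \<Sigma> N M) \<subseteq> lang_rdiv \<Sigma> N M"
  proof
    fix u assume u: "u \<in> cl \<Sigma> L (lang_rdiv \<Sigma> N M)"
    have "u @ v \<in> N" if v: "v \<in> M" for v
    proof -
      have "x @ (u @ v) @ y \<in> L" if xy: "(x, y) \<in> rhd \<Sigma> L N" for x y
      proof -
        have "(x, v @ y) \<in> rhd \<Sigma> L (lang_rdiv \<Sigma> N M)"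
          using xy v M by (force simp: rhd_def lang_rdiv_def)
        then show ?thesis using u by (auto simp: cl_def lhd_def)
      qed
      then have "u @ v \<in> cl \<Sigma> L N"
        using u v M cl_lists[of \<Sigma> L] by (auto simp: cl_def lhd_def)
      then show ?thesis using N by (simp add: closed_lang_def)
    qed
    then show "u \<in> lang_rdiv \<Sigma> N M"
      using u cl_lists[of \<Sigma> L] by (auto simp: lang_rdiv_def)
  qed
qed (auto simp: lang_rdiv_def)

lemma closed_Int:
  assumes "closed_lang \<Sigma> L M" "closed_lang \<Sigma> L N"
  shows "closed_lang \<Sigma> L (M \<inter> N)"
proof (rule closed_langI)
  show "cl \<Sigma> L (M \<inter> N) \<subseteq> M \<inter> N"
    using cl_mono[of "M \<inter> N" M \<Sigma> L] cl_mono[of "M \<inter> N" N \<Sigma> L] assms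
    by (auto simp: closed_lang_def)
qed (use closed_subset[OF assms(1)] in blast)

lemma interp_in_cone:
  assumes "scl_model \<Sigma> L Z v"
  shows "interp \<Sigma> L Z v A \<in> upper_cone \<Sigma> L Z"
proof -
  have lz: "local_zero \<Sigma> L Z" and Z1: "Z \<subseteq> cl \<Sigma> L {[]}" and v: "\<And>p. v p \<in> upper_cone \<Sigma> L Z"
    using assms by (simp_all only: scl_model_def)
  have Z: "closed_lang \<Sigma> L Z" by (rule local_zero_closed[OF lz])
  have zero: "cl \<Sigma> L (conc M Z) = Z" "cl \<Sigma> L (conc Z M) = Z" if "M \<in> upper_cone \<Sigma> L Z" for M
    using that local_zero_absorb[OF lz] by (simp_all only: upper_cone_def mem_Collect_eq)
  have Zs: "Z \<subseteq> lists \<Sigma>" by (rule closed_subset[OF Z])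
  have sub: "M \<subseteq> lists \<Sigma>" if "M \<in> upper_cone \<Sigma> L Z" for M
    using that closed_subset unfolding upper_cone_def by blast
  have absorb: "conc M Z \<subseteq> Z" "conc Z M \<subseteq> Z" if M: "M \<in> upper_cone \<Sigma> L Z" for M
  proof -
    have "conc M Z \<subseteq> lists \<Sigma>" "conc Z M \<subseteq> lists \<Sigma>"
      using sub[OF M] Zs by (simp_all add: conc_lists)
    then show "conc M Z \<subseteq> Z" "conc Z M \<subseteq> Z"
      using zero[OF M] cl_extensive[of _ \<Sigma> L] by metis+
  qed
  show ?thesis
  proof (induction A)
    case (LDiv A B)
    have "Z \<subseteq> lang_ldiv \<Sigma> (interp \<Sigma> L Z v A) (interp \<Sigma> L Z v B)"
      using absorb(1)[OF LDiv(1)] LDiv(2) Zs by (auto simp: lang_ldiv_def upper_cone_def conc_def)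
    then show ?case using closed_ldiv[OF sub[OF LDiv(1)]] LDiv(2) by (auto simp: upper_cone_def)
  next
    case (RDiv B A)
    have "Z \<subseteq> lang_rdiv \<Sigma> (interp \<Sigma> L Z v B) (interp \<Sigma> L Z v A)"
      using absorb(2)[OF RDiv(2)] RDiv(1) Zs by (auto simp: lang_rdiv_def upper_cone_def conc_def)
    then show ?case using closed_rdiv[OF sub[OF RDiv(2)]] RDiv(1) by (auto simp: upper_cone_def)
  next
    case (Prod A B)
    have "conc (interp \<Sigma> L Z v A) Z \<subseteq> conc (interp \<Sigma> L Z v A) (interp \<Sigma> L Z v B)"
      using Prod(2) by (auto simp: conc_def upper_cone_def)
    from cl_mono[OF this, of \<Sigma> L] show ?case
      using zero(1)[OF Prod(1)] by (simp add: upper_cone_def closed_cl)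
  next
    case (Join A B)
    have "interp \<Sigma> L Z v A \<union> interp \<Sigma> L Z v B \<subseteq> interp \<Sigma> L Z v (A \<squnion>\<^sub>f B)"
      using sub[OF Join(1)] sub[OF Join(2)] cl_extensive[of "interp \<Sigma> L Z v A \<union> interp \<Sigma> L Z v B"]
      by simp
    then show ?case using Join(1) by (auto simp: upper_cone_def closed_cl)
  next
    case (Star A)
    have "lang_star (interp \<Sigma> L Z v A) \<subseteq> lists \<Sigma>"
      using sub[OF Star] by (rule lang_star_lists)
    moreover have "interp \<Sigma> L Z v A \<subseteq> lang_star (interp \<Sigma> L Z v A)"
    proof
      fix w assume "w \<in> interp \<Sigma> L Z v A"
      then show "w \<in> lang_star (interp \<Sigma> L Z v A)"
        unfolding lang_star_def by (intro CollectI exI[of _ "[w]"]) simp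
    qed
    ultimately have "interp \<Sigma> L Z v A \<subseteq> interp \<Sigma> L Z v (Star A)"
      using cl_extensive[of "lang_star (interp \<Sigma> L Z v A)" \<Sigma> L] by simp
    then show ?case using Star by (auto simp: upper_cone_def closed_cl)
  next
    case (Meet A B)
    then show ?case by (simp add: upper_cone_def closed_Int)
  qed (use Z Z1 Zs v in \<open>simp_all add: upper_cone_def closed_lists closed_cl\<close>)
qed

end

theory Submission
  imports Defs
begin

text \<open>
  The letters of the canonical model are formulae and barred formulae. A word belongs to the
  language \<open>L\<close> iff it contains at least two bars, or it has the form \<open>\<Gamma>, bar C, \<Delta>\<close> with exactly
  one bar and the sequent \<open>\<Delta>, \<Gamma> \<rightarrow> C\<close> is derivable. Because of the cyclic shift, every context with
  one bar acts on bar-free words as a sequent context \<open>\<Delta>\<^sub>1, _, \<Delta>\<^sub>2 \<rightarrow> C\<close>, including on the empty word.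
  A context without bars sends bar-free words outside \<open>L\<close>, and a context with at least two bars
  imposes no condition, so the closure of a language with a bar-free word contains all words with
  bars and is on bar-free words the closure given by derivability. A formula \<open>A\<close> then denotes the
  words with bars together with the antecedents that derive \<open>A\<close>, and \<open>Bot\<close> denotes a local zero,
  though not the least closed language.
\<close>

text \<open>Countability lets natural numbers serve as letters of the canonical model, as the
  alphabets of the theorem require.\<close>

instance fm :: (countable) countable
  by countable_datatype

section \<open>Sets of antecedents and the canonical language\<close>

definition antecedents :: "'v sequent set \<Rightarrow> 'v fm \<Rightarrow> 'v fm list set" where
  "antecedents H A = {\<Gamma>. derivable H \<Gamma> A}"

text \<open>The closure operator of the Galois connection that derivability induces between
  antecedents and one-hole sequent contexts.\<close>

definition seq_cl :: "'v sequent set \<Rightarrow> 'v fm list set \<Rightarrow> 'v fm list set" where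
  "seq_cl H X = {\<Gamma>. \<forall>\<Delta>1 \<Delta>2 C. (\<forall>G\<in>X. derivable H (\<Delta>1 @ G @ \<Delta>2) C) \<longrightarrow>
     derivable H (\<Delta>1 @ \<Gamma> @ \<Delta>2) C}"

text \<open>A map \<open>d\<close> from letters to formulae and barred formulae decodes words; in a left summand stand
  the unbarred formulae.\<close>

definition canon_lang :: "('a \<Rightarrow> 'v fm + 'v fm) \<Rightarrow> 'v sequent set \<Rightarrow> 'a lang" where
  "canon_lang d H = {w. (\<nexists>\<Gamma>. map d w = map Inl \<Gamma>) \<and>
     (\<forall>\<Gamma> C \<Delta>. map d w = map Inl \<Gamma> @ [Inr C] @ map Inl \<Delta> \<longrightarrow> derivable H (\<Delta> @ \<Gamma>) C)}"

definition barfree_part :: "('a \<Rightarrow> 'b + 'c) \<Rightarrow> 'a lang \<Rightarrow> 'b lang" where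
  "barfree_part d M = {\<Gamma>. \<exists>w\<in>M. map d w = map Inl \<Gamma>}"

text \<open>The condition is vacuous on words with a bar, so all of them belong. For surjective
  \<open>d\<close> this is the largest language with bar-free part \<open>X\<close>.\<close>

definition with_bars :: "('a \<Rightarrow> 'b + 'c) \<Rightarrow> 'b lang \<Rightarrow> 'a lang" where
  "with_bars d X = {w. \<forall>\<Gamma>. map d w = map Inl \<Gamma> \<longrightarrow> \<Gamma> \<in> X}"

section \<open>Locating a bar in a decoded word\<close>

lemma seq_clD:
  assumes "\<Gamma> \<in> seq_cl H X" "\<And>G. G \<in> X \<Longrightarrow> derivable H (\<Delta>1 @ G @ \<Delta>2) C"
  shows "derivable H (\<Delta>1 @ \<Gamma> @ \<Delta>2) C"
  using assms unfolding seq_cl_def by blast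

lemma map_Inl_eq_iff [simp]: "map Inl xs = map Inl ys \<longleftrightarrow> xs = ys"
  by (simp add: inj_map_eq_map)

lemma map_Inl_eq_append_iff:
  "map Inl \<Gamma> = xs @ ys \<longleftrightarrow> (\<exists>\<Gamma>1 \<Gamma>2. \<Gamma> = \<Gamma>1 @ \<Gamma>2 \<and> xs = map Inl \<Gamma>1 \<and> ys = map Inl \<Gamma>2)"
  by (auto simp: map_eq_append_conv)

lemmas append_eq_map_Inl_iff = trans[OF eq_commute map_Inl_eq_append_iff]

lemma Inr_notin_map_Inl [simp]: "Inr c \<notin> set (map Inl xs)"
  by auto

text \<open>The only bar falls into exactly one of the two factors. Applied twice, this locates it
  in the prefix, middle or suffix of \<open>x @ w @ y\<close>.\<close>

lemma append_eq_single_bar: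
  assumes "xs @ ys = map Inl \<Gamma> @ [Inr C] @ map Inl \<Delta>"
  obtains (left) \<Delta>1 \<Delta>2 where "xs = map Inl \<Gamma> @ [Inr C] @ map Inl \<Delta>1" "ys = map Inl \<Delta>2"
      "\<Delta> = \<Delta>1 @ \<Delta>2"
    | (right) \<Gamma>1 \<Gamma>2 where "xs = map Inl \<Gamma>1" "ys = map Inl \<Gamma>2 @ [Inr C] @ map Inl \<Delta>"
      "\<Gamma> = \<Gamma>1 @ \<Gamma>2"
proof -
  consider us where "xs @ us = map Inl \<Gamma>" "ys = us @ [Inr C] @ map Inl \<Delta>"
    | us where "xs = map Inl \<Gamma> @ us" "us @ ys = Inr C # map Inl \<Delta>"
    using assms by (auto simp: append_eq_append_conv2)
  then show ?thesis
  proof cases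
    case 1
    then show ?thesis using right by (auto simp: append_eq_map_Inl_iff)
  next
    case 2
    show ?thesis
    proof (cases us)
      \<comment> \<open>The cut lies immediately before the bar, so the bar goes to
        \<open>ys\<close>.\<close>
      case Nil
      then show ?thesis using 2 right[of \<Gamma> "[]"] by simp
    next
      case (Cons u us')
      then show ?thesis using 2 left by (auto simp: append_eq_map_Inl_iff)
    qed
  qed
qed

lemma single_bar_at_end_iff:
  "xs @ [Inr C] = map Inl \<Gamma> @ [Inr C'] @ map Inl \<Delta> \<longleftrightarrow> xs = map Inl \<Gamma> \<and> C = C' \<and> \<Delta> = []"
  by (cases \<Delta> rule: rev_cases) auto

section \<open>Bar-free parts of languages and their extension by barred words\<close>

lemma obtain_decoded:
  assumes "surj d"
  obtains w where "map d w = xs"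
proof
  show "map d (map (inv d) xs) = xs" using assms by (simp add: map_idI surj_f_inv_f)
qed

lemma barfree_part_with_bars:
  assumes "surj d"
  shows "barfree_part d (with_bars d X) = X"
proof (intro equalityI subsetI)
  fix \<Gamma> assume "\<Gamma> \<in> X"
  moreover obtain w where "map d w = map Inl \<Gamma>" using obtain_decoded[OF assms] .
  ultimately show "\<Gamma> \<in> barfree_part d (with_bars d X)"
    by (auto simp: barfree_part_def with_bars_def intro!: exI[of _ w])
qed (auto simp: barfree_part_def with_bars_def)

lemma with_bars_Nil: "[] \<in> with_bars d X \<longleftrightarrow> [] \<in> X"
  by (auto simp: with_bars_def)

lemma with_bars_mono: "X \<subseteq> Y \<Longrightarrow> with_bars d X \<subseteq> with_bars d Y"
  by (auto simp: with_bars_def)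

lemma barfree_part_mono: "M \<subseteq> N \<Longrightarrow> barfree_part d M \<subseteq> barfree_part d N"
  by (auto simp: barfree_part_def)

lemma with_bars_subset_iff: "surj d \<Longrightarrow> with_bars d X \<subseteq> with_bars d Y \<longleftrightarrow> X \<subseteq> Y"
  by (metis barfree_part_mono barfree_part_with_bars with_bars_mono)

text \<open>A concatenation is bar-free exactly when both factors are, so no bar-free word arises
  from words with bars. The same reason works for the star below.\<close>

lemma barfree_part_conc:
  "barfree_part d (conc M N) = conc (barfree_part d M) (barfree_part d N)"
proof (intro equalityI subsetI)
  fix \<Gamma> assume "\<Gamma> \<in> conc (barfree_part d M) (barfree_part d N)"
  then obtain u v \<Gamma>1 \<Gamma>2 where "\<Gamma> = \<Gamma>1 @ \<Gamma>2" "u \<in> M" "v \<in> N" "map d u = map Inl \<Gamma>1"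
    "map d v = map Inl \<Gamma>2"
    by (auto simp: barfree_part_def conc_def)
  then have "u @ v \<in> conc M N" "map d (u @ v) = map Inl \<Gamma>" by (auto simp: conc_def)
  then show "\<Gamma> \<in> barfree_part d (conc M N)" by (auto simp only: barfree_part_def)
qed (fastforce simp: barfree_part_def conc_def append_eq_map_Inl_iff)

lemma barfree_part_Un: "barfree_part d (M \<union> N) = barfree_part d M \<union> barfree_part d N"
  by (auto simp: barfree_part_def)

lemma barfree_part_lang_star:
  "barfree_part d (lang_star M) = lang_star (barfree_part d M)"
proof (intro equalityI subsetI)
  fix \<Gamma> assume "\<Gamma> \<in> barfree_part d (lang_star M)"
  then obtain ws where "ws \<in> lists M" "map d (concat ws) = map Inl \<Gamma>"
    by (auto simp: barfree_part_def lang_star_def)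
  then show "\<Gamma> \<in> lang_star (barfree_part d M)"
  proof (induction ws arbitrary: \<Gamma>)
    case Nil
    then show ?case by (auto simp: lang_star_def intro!: exI[of _ "[]"])
  next
    case (Cons w ws)
    then obtain \<Gamma>1 \<Gamma>2 where \<Gamma>: "\<Gamma> = \<Gamma>1 @ \<Gamma>2" "map d w = map Inl \<Gamma>1"
      "map d (concat ws) = map Inl \<Gamma>2"
      by (metis concat.simps(2) map_append map_Inl_eq_append_iff)
    with Cons obtain Ps where "Ps \<in> lists (barfree_part d M)" "\<Gamma>2 = concat Ps"
      by (auto simp: lang_star_def)
    moreover have "\<Gamma>1 \<in> barfree_part d M" using \<Gamma> Cons by (auto simp: barfree_part_def)
    ultimately show ?case using \<Gamma> by (auto simp: lang_star_def intro!: exI[of _ "\<Gamma>1 # Ps"])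
  qed
next
  fix \<Gamma> assume "\<Gamma> \<in> lang_star (barfree_part d M)"
  then obtain Ps where "Ps \<in> lists (barfree_part d M)" "\<Gamma> = concat Ps"
    by (auto simp: lang_star_def)
  then have "\<exists>ws\<in>lists M. map d (concat ws) = map Inl \<Gamma>"
  proof (induction Ps arbitrary: \<Gamma>)
    case Nil
    then show ?case by (auto intro!: bexI[of _ "[]"])
  next
    case (Cons G Ps)
    then obtain w ws where "w \<in> M" "map d w = map Inl G" "ws \<in> lists M"
      "map d (concat ws) = map Inl (concat Ps)"
      by (auto simp: barfree_part_def)
    then show ?case using Cons by (auto intro!: bexI[of _ "w # ws"])
  qed
  then show "\<Gamma> \<in> barfree_part d (lang_star M)"
    by (auto simp: barfree_part_def lang_star_def)
qed

text \<open>If either factor has a bar, so does the concatenation, which then lies in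
  \<open>with_bars d Y\<close> automatically. Only pairs of bar-free words matter, and surjectivity
  provides a word for each member of \<open>X\<close>.\<close>

lemma lang_ldiv_with_bars:
  assumes "surj d"
  shows "lang_ldiv UNIV (with_bars d X) (with_bars d Y) = with_bars d (lang_ldiv UNIV X Y)"
proof (intro equalityI subsetI)
  fix u assume u: "u \<in> lang_ldiv UNIV (with_bars d X) (with_bars d Y)"
  have "G @ \<Gamma> \<in> Y" if "map d u = map Inl \<Gamma>" "G \<in> X" for \<Gamma> G
  proof -
    obtain w where w: "map d w = map Inl G" using obtain_decoded[OF assms] .
    then have "w \<in> with_bars d X" using that by (auto simp: with_bars_def)
    then have "w @ u \<in> with_bars d Y" using u by (auto simp: lang_ldiv_def)
    moreover have "map d (w @ u) = map Inl (G @ \<Gamma>)" using w that by simp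
    ultimately show ?thesis unfolding with_bars_def by blast
  qed
  then show "u \<in> with_bars d (lang_ldiv UNIV X Y)"
    by (auto simp: with_bars_def lang_ldiv_def)
qed (auto simp: with_bars_def lang_ldiv_def append_eq_map_Inl_iff)

lemma lang_rdiv_with_bars:
  assumes "surj d"
  shows "lang_rdiv UNIV (with_bars d Y) (with_bars d X) = with_bars d (lang_rdiv UNIV Y X)"
proof (intro equalityI subsetI)
  fix u assume u: "u \<in> lang_rdiv UNIV (with_bars d Y) (with_bars d X)"
  have "\<Gamma> @ G \<in> Y" if "map d u = map Inl \<Gamma>" "G \<in> X" for \<Gamma> G
  proof -
    obtain w where w: "map d w = map Inl G" using obtain_decoded[OF assms] .
    then have "w \<in> with_bars d X" using that by (auto simp: with_bars_def)
    then have "u @ w \<in> with_bars d Y" using u by (auto simp: lang_rdiv_def)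
    moreover have "map d (u @ w) = map Inl (\<Gamma> @ G)" using w that by simp
    ultimately show ?thesis unfolding with_bars_def by blast
  qed
  then show "u \<in> with_bars d (lang_rdiv UNIV Y X)"
    by (auto simp: with_bars_def lang_rdiv_def)
qed (auto simp: with_bars_def lang_rdiv_def append_eq_map_Inl_iff)

section \<open>Closure with respect to the canonical language\<close>

text \<open>This transfers every closed operation from words to antecedents. The bar-free word in
  \<open>M\<close> serves to exclude contexts without bars.\<close>

lemma cl_canon_lang:
  assumes d: "surj d" and ne: "barfree_part d M \<noteq> {}"
  shows "cl UNIV (canon_lang d H) M = with_bars d (seq_cl H (barfree_part d M))"
proof (intro equalityI subsetI)
  fix w assume w: "w \<in> cl UNIV (canon_lang d H) M"
  have "derivable H (\<Delta>1 @ \<Gamma> @ \<Delta>2) C"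
    if \<Gamma>: "map d w = map Inl \<Gamma>"
      and G: "\<forall>G\<in>barfree_part d M. derivable H (\<Delta>1 @ G @ \<Delta>2) C" for \<Gamma> \<Delta>1 \<Delta>2 C
  proof -
    \<comment> \<open>A bar at the very end makes the cyclic shift trivial, so \<open>(x, y)\<close>
      encodes exactly the given sequent context.\<close>
    obtain x where x: "map d x = map Inl \<Delta>1" using obtain_decoded[OF d] .
    obtain y where y: "map d y = map Inl \<Delta>2 @ [Inr C]" using obtain_decoded[OF d] .
    have "x @ u @ y \<in> canon_lang d H" if u: "u \<in> M" for u
      unfolding canon_lang_def
    proof (intro CollectI conjI notI allI impI)
      assume "\<exists>\<Gamma>. map d (x @ u @ y) = map Inl \<Gamma>"
      then show False using y
        by (metis Inr_notin_map_Inl in_set_conv_decomp map_append append.assoc)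
    next
      fix \<Gamma>' C' \<Delta>'
      assume "map d (x @ u @ y) = map Inl \<Gamma>' @ [Inr C'] @ map Inl \<Delta>'"
      then have "(map Inl \<Delta>1 @ map d u @ map Inl \<Delta>2) @ [Inr C] = map Inl \<Gamma>' @ [Inr C'] @ map Inl \<Delta>'"
        using x y by simp
      then have *: "map Inl \<Delta>1 @ map d u @ map Inl \<Delta>2 = map Inl \<Gamma>'" "C' = C" "\<Delta>' = []"
        unfolding single_bar_at_end_iff by auto
      then obtain G' where "map d u = map Inl G'" "\<Gamma>' = \<Delta>1 @ G' @ \<Delta>2"
        by (auto simp: append_eq_map_Inl_iff)
      then show "derivable H (\<Delta>' @ \<Gamma>') C'"
        using G u * by (auto simp: barfree_part_def)
    qed
    then have "(x, y) \<in> rhd UNIV (canon_lang d H) M" by (auto simp: rhd_def)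
    then have "x @ w @ y \<in> canon_lang d H" using w by (auto simp: cl_def lhd_def)
    moreover have "map d (x @ w @ y) = map Inl (\<Delta>1 @ \<Gamma> @ \<Delta>2) @ [Inr C] @ map Inl []"
      using x y \<Gamma> by simp
    ultimately have "derivable H ([] @ \<Delta>1 @ \<Gamma> @ \<Delta>2) C" unfolding canon_lang_def by blast
    then show ?thesis by simp
  qed
  then show "w \<in> with_bars d (seq_cl H (barfree_part d M))"
    by (auto simp: with_bars_def seq_cl_def)
next
  fix w assume w: "w \<in> with_bars d (seq_cl H (barfree_part d M))"
  have "x @ w @ y \<in> canon_lang d H" if xy: "(x, y) \<in> rhd UNIV (canon_lang d H) M" for x y
  proof -
    have M: "x @ u @ y \<in> canon_lang d H" if "u \<in> M" for u
      using that xy by (auto simp: rhd_def)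
    \<comment> \<open>A context without bars around a bar-free word of \<open>M\<close> would give a
      bar-free word, which is never in the canonical language.\<close>
    have bar: "\<not> (map d x = map Inl \<Delta>1 \<and> map d y = map Inl \<Delta>2)" for \<Delta>1 \<Delta>2
    proof
      assume "map d x = map Inl \<Delta>1 \<and> map d y = map Inl \<Delta>2"
      moreover obtain u G where u: "u \<in> M" "map d u = map Inl G"
        using ne by (auto simp: barfree_part_def)
      ultimately have "map d (x @ u @ y) = map Inl (\<Delta>1 @ G @ \<Delta>2)" by simp
      then show False using M[OF u(1)] unfolding canon_lang_def by blast
    qed
    have w_cl: "derivable H (\<Delta>1 @ \<Gamma> @ \<Delta>2) C"
      if "map d w = map Inl \<Gamma>"
        "\<And>G u. u \<in> M \<Longrightarrow> map d u = map Inl G \<Longrightarrow> derivable H (\<Delta>1 @ G @ \<Delta>2) C" for \<Delta>1 \<Gamma> \<Delta>2 C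
    proof (rule seq_clD)
      show "\<Gamma> \<in> seq_cl H (barfree_part d M)" using that(1) w by (simp add: with_bars_def)
    qed (use that(2) in \<open>auto simp: barfree_part_def\<close>)
    have M_der: "derivable H (\<Delta> @ \<Gamma>) C"
      if "u \<in> M" "map d (x @ u @ y) = map Inl \<Gamma> @ [Inr C] @ map Inl \<Delta>" for u \<Gamma> C \<Delta>
      using that M unfolding canon_lang_def by blast
    show ?thesis unfolding canon_lang_def
    proof (intro CollectI conjI notI allI impI)
      assume "\<exists>\<Gamma>. map d (x @ w @ y) = map Inl \<Gamma>"
      then show False using bar by (metis map_append map_Inl_eq_append_iff)
    next
      fix \<Gamma> C \<Delta>
      assume "map d (x @ w @ y) = map Inl \<Gamma> @ [Inr C] @ map Inl \<Delta>"
      then have "map d x @ (map d w @ map d y) = map Inl \<Gamma> @ [Inr C] @ map Inl \<Delta>" by simp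
      then show "derivable H (\<Delta> @ \<Gamma>) C"
      proof (cases rule: append_eq_single_bar)
        \<comment> \<open>The bar is in \<open>x\<close>. After the shift the hole, filled by
          \<open>\<Delta>3\<close>, has \<open>\<Delta>1\<close> to its left and
          \<open>\<Delta>4 @ \<Gamma>\<close> to its right.\<close>
        case (left \<Delta>1 \<Delta>2)
        then obtain \<Delta>3 \<Delta>4 where *: "map d w = map Inl \<Delta>3" "map d y = map Inl \<Delta>4" "\<Delta>2 = \<Delta>3 @ \<Delta>4"
          by (metis map_Inl_eq_append_iff)
        have "derivable H (\<Delta>1 @ \<Delta>3 @ (\<Delta>4 @ \<Gamma>)) C"
        proof (rule w_cl[OF *(1)])
          fix G u assume u: "u \<in> M" "map d u = map Inl G"
          have "derivable H ((\<Delta>1 @ G @ \<Delta>4) @ \<Gamma>) C"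
            using M_der[OF u(1), of \<Gamma> C "\<Delta>1 @ G @ \<Delta>4"] left * u by simp
          then show "derivable H (\<Delta>1 @ G @ (\<Delta>4 @ \<Gamma>)) C" by simp
        qed
        then show ?thesis using left * by simp
      next
        case (right \<Gamma>1 \<Gamma>2)
        note r = right
        from right(2) show ?thesis
        proof (cases rule: append_eq_single_bar)
          \<comment> \<open>A bar in \<open>w\<close> would be the only one, leaving both
            \<open>x\<close> and \<open>y\<close> bar-free.\<close>
          case (left \<Delta>1 \<Delta>2)
          then show ?thesis using bar r by blast
        next
          \<comment> \<open>The bar is in \<open>y\<close>. After the shift the hole, filled by
            \<open>\<Gamma>3\<close>, has \<open>\<Delta> @ \<Gamma>1\<close> to its left and
            \<open>\<Gamma>4\<close> to its right.\<close>
          case (right \<Gamma>3 \<Gamma>4)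
          have "derivable H ((\<Delta> @ \<Gamma>1) @ \<Gamma>3 @ \<Gamma>4) C"
          proof (rule w_cl[OF right(1)])
            fix G u assume u: "u \<in> M" "map d u = map Inl G"
            have "derivable H (\<Delta> @ (\<Gamma>1 @ G @ \<Gamma>4)) C"
              using M_der[OF u(1), of "\<Gamma>1 @ G @ \<Gamma>4" C \<Delta>] r right u by simp
            then show "derivable H ((\<Delta> @ \<Gamma>1) @ G @ \<Gamma>4) C" by simp
          qed
          then show ?thesis using r right by simp
        qed
      qed
    qed
  qed
  then show "w \<in> cl UNIV (canon_lang d H) M" by (auto simp: cl_def lhd_def)
qed

section \<open>The operations on sets of antecedents\<close>

text \<open>The two assumptions abstract the right and left rules of a connective. The first gives
  one inclusion through the empty context with succedent \<open>A\<close>; the second gives the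
  other by a cut on \<open>A\<close>.\<close>

lemma seq_cl_eq_antecedents:
  assumes "\<And>G. G \<in> X \<Longrightarrow> derivable H G A"
    and "\<And>\<Delta>1 \<Delta>2 C. (\<And>G. G \<in> X \<Longrightarrow> derivable H (\<Delta>1 @ G @ \<Delta>2) C) \<Longrightarrow>
      derivable H (\<Delta>1 @ [A] @ \<Delta>2) C"
  shows "seq_cl H X = antecedents H A"
proof (intro equalityI subsetI)
  fix \<Gamma> assume "\<Gamma> \<in> seq_cl H X"
  from seq_clD[OF this, of "[]" "[]" A] show "\<Gamma> \<in> antecedents H A"
    using assms(1) by (simp add: antecedents_def)
next
  fix \<Gamma> assume "\<Gamma> \<in> antecedents H A"
  then show "\<Gamma> \<in> seq_cl H X"
    using assms(2) derivable.cut[of H \<Gamma> A] by (auto simp: antecedents_def seq_cl_def)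
qed

lemma singleton_in_antecedents: "[A] \<in> antecedents H A"
  by (simp add: antecedents_def derivable.ax)

lemma Bot_below: "derivable H \<Gamma> Bot \<Longrightarrow> derivable H (\<Delta>1 @ \<Gamma> @ \<Delta>2) C"
  by (rule derivable.cut[OF _ derivable.botL])

lemma seq_cl_antecedents: "seq_cl H (antecedents H A) = antecedents H A"
proof (rule seq_cl_eq_antecedents)
  fix \<Delta>1 \<Delta>2 C
  assume "\<And>G. G \<in> antecedents H A \<Longrightarrow> derivable H (\<Delta>1 @ G @ \<Delta>2) C"
  then show "derivable H (\<Delta>1 @ [A] @ \<Delta>2) C" using singleton_in_antecedents .
qed (simp add: antecedents_def)

lemma seq_cl_One: "seq_cl H {[]} = antecedents H One"
proof (rule seq_cl_eq_antecedents)
  fix \<Delta>1 \<Delta>2 C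
  assume "\<And>G. G \<in> {[]} \<Longrightarrow> derivable H (\<Delta>1 @ G @ \<Delta>2) C"
  from this[of "[]"] show "derivable H (\<Delta>1 @ [One] @ \<Delta>2) C" by (intro derivable.oneL) simp
qed (simp add: derivable.oneR)

lemma seq_cl_Prod:
  "seq_cl H (conc (antecedents H A) (antecedents H B)) = antecedents H (A \<odot> B)"
proof (rule seq_cl_eq_antecedents)
  fix \<Delta>1 \<Delta>2 C
  assume "\<And>G. G \<in> conc (antecedents H A) (antecedents H B) \<Longrightarrow> derivable H (\<Delta>1 @ G @ \<Delta>2) C"
  moreover have "[A] @ [B] \<in> conc (antecedents H A) (antecedents H B)"
    unfolding conc_def using singleton_in_antecedents by blast
  ultimately have "derivable H (\<Delta>1 @ [A, B] @ \<Delta>2) C" by fastforce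
  then show "derivable H (\<Delta>1 @ [A \<odot> B] @ \<Delta>2) C" by (rule derivable.prodL)
qed (auto simp: conc_def antecedents_def intro: derivable.prodR)

lemma seq_cl_Join: "seq_cl H (antecedents H A \<union> antecedents H B) = antecedents H (A \<squnion>\<^sub>f B)"
proof (rule seq_cl_eq_antecedents)
  fix \<Delta>1 \<Delta>2 C
  assume "\<And>G. G \<in> antecedents H A \<union> antecedents H B \<Longrightarrow> derivable H (\<Delta>1 @ G @ \<Delta>2) C"
  then show "derivable H (\<Delta>1 @ [A \<squnion>\<^sub>f B] @ \<Delta>2) C"
    by (intro derivable.joinL) (use singleton_in_antecedents in blast)+
qed (auto simp: antecedents_def intro: derivable.joinR1 derivable.joinR2)

lemma seq_cl_Star: "seq_cl H (lang_star (antecedents H A)) = antecedents H (Star A)"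
proof (rule seq_cl_eq_antecedents)
  fix G assume "G \<in> lang_star (antecedents H A)"
  then show "derivable H G (Star A)"
    by (auto simp: lang_star_def antecedents_def intro!: derivable.starR)
next
  fix \<Delta>1 \<Delta>2 C
  assume *: "\<And>G. G \<in> lang_star (antecedents H A) \<Longrightarrow> derivable H (\<Delta>1 @ G @ \<Delta>2) C"
  \<comment> \<open>Ranging over all \<open>n\<close>, these lists give the infinitely many premises
    of \<open>starL\<close>.\<close>
  have "replicate n A \<in> lang_star (antecedents H A)" for n
  proof -
    have "replicate n A = concat (replicate n [A])" by (induction n) auto
    moreover have "replicate n [A] \<in> lists (antecedents H A)"
      using singleton_in_antecedents by (auto simp: in_lists_conv_set)
    ultimately show ?thesis unfolding lang_star_def by blast
  qed
  then show "derivable H (\<Delta>1 @ [Star A] @ \<Delta>2) C"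
    using * by (intro derivable.starL) auto
qed

text \<open>The singleton \<open>[A]\<close> is a generic denominator: testing on it gives the
  premise of \<open>ldivR\<close>. The converse is a cut with the instance of \<open>ldivL\<close>
  that has \<open>B\<close> as succedent.\<close>

lemma ldiv_antecedents:
  "lang_ldiv UNIV (antecedents H A) (antecedents H B) = antecedents H (A \<rightharpoonup> B)"
proof (intro equalityI subsetI)
  fix \<Gamma> assume "\<Gamma> \<in> lang_ldiv UNIV (antecedents H A) (antecedents H B)"
  then have "derivable H ([A] @ \<Gamma>) B"
    using singleton_in_antecedents[of A H] by (auto simp: lang_ldiv_def antecedents_def)
  then show "\<Gamma> \<in> antecedents H (A \<rightharpoonup> B)" by (simp add: antecedents_def derivable.ldivR)
next
  fix \<Gamma> assume \<Gamma>: "\<Gamma> \<in> antecedents H (A \<rightharpoonup> B)"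
  have "derivable H (G @ \<Gamma>) B" if "derivable H G A" for G
    using derivable.cut[of H \<Gamma> "A \<rightharpoonup> B" G "[]" B] \<Gamma>
      derivable.ldivL[OF that, of "[]" B "[]" B] derivable.ax[of H B]
    by (simp add: antecedents_def)
  then show "\<Gamma> \<in> lang_ldiv UNIV (antecedents H A) (antecedents H B)"
    by (auto simp: lang_ldiv_def antecedents_def)
qed

lemma rdiv_antecedents:
  "lang_rdiv UNIV (antecedents H B) (antecedents H A) = antecedents H (B \<leftharpoonup> A)"
proof (intro equalityI subsetI)
  fix \<Gamma> assume "\<Gamma> \<in> lang_rdiv UNIV (antecedents H B) (antecedents H A)"
  then have "derivable H (\<Gamma> @ [A]) B"
    using singleton_in_antecedents[of A H] by (auto simp: lang_rdiv_def antecedents_def)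
  then show "\<Gamma> \<in> antecedents H (B \<leftharpoonup> A)" by (simp add: antecedents_def derivable.rdivR)
next
  fix \<Gamma> assume \<Gamma>: "\<Gamma> \<in> antecedents H (B \<leftharpoonup> A)"
  have "derivable H (\<Gamma> @ G) B" if "derivable H G A" for G
    using derivable.cut[of H \<Gamma> "B \<leftharpoonup> A" "[]" G B] \<Gamma>
      derivable.rdivL[OF that, of "[]" B "[]" B] derivable.ax[of H B]
    by (simp add: antecedents_def)
  then show "\<Gamma> \<in> lang_rdiv UNIV (antecedents H B) (antecedents H A)"
    by (auto simp: lang_rdiv_def antecedents_def)
qed

lemma meet_antecedents: "antecedents H A \<inter> antecedents H B = antecedents H (A \<sqinter>\<^sub>f B)"
proof (intro equalityI subsetI)
  fix \<Gamma> assume \<Gamma>: "\<Gamma> \<in> antecedents H (A \<sqinter>\<^sub>f B)"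
  have "derivable H [A \<sqinter>\<^sub>f B] A" "derivable H [A \<sqinter>\<^sub>f B] B"
    using derivable.meetL1[of H "[]" A "[]" A B] derivable.meetL2[of H "[]" B "[]" B A]
    by (auto intro: derivable.ax)
  then show "\<Gamma> \<in> antecedents H A \<inter> antecedents H B"
    using \<Gamma> derivable.cut[of H \<Gamma> "A \<sqinter>\<^sub>f B" "[]" "[]"] by (auto simp: antecedents_def)
qed (auto simp: antecedents_def intro: derivable.meetR)

section \<open>The canonical model\<close>

abbreviation canon_val :: "('a \<Rightarrow> 'v fm + 'v fm) \<Rightarrow> 'v sequent set \<Rightarrow> 'v fm \<Rightarrow> 'a lang" where
  "canon_val d H A \<equiv> with_bars d (antecedents H A)"

text \<open>\<open>Var\<close> and \<open>Bot\<close> hold by the choice of valuation and zero.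
  Divisions and meet are computed without closure; for \<open>One\<close>, product, join and star,
  \<open>cl_canon_lang\<close> reduces the closure to \<open>seq_cl\<close>.\<close>

lemma interp_canonical:
  assumes d: "surj d"
  shows "interp UNIV (canon_lang d H) (canon_val d H Bot) (\<lambda>p. canon_val d H (Var p)) A =
    canon_val d H A"
proof (induction A)
  case Top
  then show ?case by (auto simp: with_bars_def antecedents_def intro: derivable.topR)
next
  case One
  have "barfree_part d {[]} = {[]}" by (auto simp: barfree_part_def)
  then show ?case by (simp add: cl_canon_lang[OF d] seq_cl_One)
next
  case (LDiv A B)
  then show ?case by (simp add: lang_ldiv_with_bars[OF d] ldiv_antecedents)
next
  case (RDiv B A)
  then show ?case by (simp add: lang_rdiv_with_bars[OF d] rdiv_antecedents)
next
  case (Prod A B)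
  have "conc (antecedents H A) (antecedents H B) \<noteq> {}"
    unfolding conc_def using singleton_in_antecedents by blast
  with Prod show ?case
    by (simp add: cl_canon_lang[OF d] barfree_part_conc barfree_part_with_bars[OF d] seq_cl_Prod)
next
  case (Meet A B)
  have "canon_val d H A \<inter> canon_val d H B = with_bars d (antecedents H A \<inter> antecedents H B)"
    by (auto simp: with_bars_def)
  with Meet show ?case by (simp add: meet_antecedents)
next
  case (Join A B)
  have "antecedents H A \<union> antecedents H B \<noteq> {}"
    using singleton_in_antecedents by blast
  with Join show ?case
    by (simp add: cl_canon_lang[OF d] barfree_part_Un barfree_part_with_bars[OF d] seq_cl_Join)
next
  case (Star A)
  have "lang_star (antecedents H A) \<noteq> {}"
    unfolding lang_star_def by auto
  with Star show ?case
    by (simp add: cl_canon_lang[OF d] barfree_part_lang_star barfree_part_with_bars[OF d]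
        seq_cl_Star)
qed simp_all

lemma closed_canon_val:
  assumes "surj d"
  shows "closed_lang UNIV (canon_lang d H) (canon_val d H A)"
proof -
  have "antecedents H A \<noteq> {}" using singleton_in_antecedents by blast
  then show ?thesis
    by (simp add: closed_lang_def cl_canon_lang[OF assms] barfree_part_with_bars[OF assms]
        seq_cl_antecedents)
qed

lemma canon_val_Bot_subset: "canon_val d H Bot \<subseteq> canon_val d H A"
  using Bot_below[of H _ "[]" "[]" A] by (intro with_bars_mono) (auto simp: antecedents_def)

text \<open>Whatever stands beside an antecedent of \<open>Bot\<close>, the whole list derives
  \<open>Bot\<close>, and by \<open>botL\<close> every context accepts \<open>Bot\<close>. Both
  products therefore close up to the antecedents of \<open>Bot\<close>.\<close>

lemma local_zero_canonical:
  assumes d: "surj d"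
  shows "local_zero UNIV (canon_lang d H) (canon_val d H Bot)"
  unfolding local_zero_def
proof (intro conjI allI impI)
  fix M assume "canon_val d H Bot \<subseteq> M"
  then have "barfree_part d (canon_val d H Bot) \<subseteq> barfree_part d M"
    by (auto simp: barfree_part_def)
  \<comment> \<open>Membership of \<open>[Bot]\<close> makes the bar-free parts of both products
    nonempty, so that \<open>cl_canon_lang\<close> applies.\<close>
  then have Bot: "[Bot] \<in> barfree_part d M"
    using singleton_in_antecedents barfree_part_with_bars[OF d] by blast
  have left: "seq_cl H (conc (barfree_part d M) (antecedents H Bot)) = antecedents H Bot"
    using Bot_below[of H _ _ "[]"]
    by (intro seq_cl_eq_antecedents)
      (auto simp: conc_def antecedents_def intro: derivable.botL[simplified])
  have right: "seq_cl H (conc (antecedents H Bot) (barfree_part d M)) = antecedents H Bot"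
    using Bot_below[of H _ "[]"]
    by (intro seq_cl_eq_antecedents)
      (auto simp: conc_def antecedents_def intro: derivable.botL[simplified])
  have "conc (barfree_part d M) (antecedents H Bot) \<noteq> {}"
    "conc (antecedents H Bot) (barfree_part d M) \<noteq> {}"
    using Bot singleton_in_antecedents[of Bot H] unfolding conc_def by blast+
  then show "cl UNIV (canon_lang d H) (conc M (canon_val d H Bot)) = canon_val d H Bot"
    "cl UNIV (canon_lang d H) (conc (canon_val d H Bot) M) = canon_val d H Bot"
    by (simp_all add: cl_canon_lang[OF d] barfree_part_conc barfree_part_with_bars[OF d] left right)
qed (rule closed_canon_val[OF d])

lemma scl_model_canonical:
  assumes "surj d"
  shows "scl_model UNIV (canon_lang d H) (canon_val d H Bot) (\<lambda>p. canon_val d H (Var p))"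
proof -
  \<comment> \<open>This turns the condition that the zero lies below the unit into
    \<open>canon_val_Bot_subset\<close>.\<close>
  have "cl UNIV (canon_lang d H) {[]} = canon_val d H One"
    using interp_canonical[OF assms, of H One] by simp
  then show ?thesis
    using local_zero_canonical[OF assms] closed_canon_val[OF assms] canon_val_Bot_subset[of d H]
    by (simp add: scl_model_def upper_cone_def)
qed

section \<open>Truth in the canonical model and completeness\<close>

lemma foldl_interp_Prod:
  "foldl (\<lambda>M D. cl \<Sigma> L (conc M (interp \<Sigma> L Z v D))) (interp \<Sigma> L Z v A) \<Gamma> =
    interp \<Sigma> L Z v (foldl Prod A \<Gamma>)"
proof (induction \<Gamma> arbitrary: A)
  case (Cons B \<Gamma>)
  show ?case using Cons[of "A \<odot> B"] by simp
qed simp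

text \<open>The rule \<open>prodL\<close> is invertible by a cut with
  \<open>A, D \<rightarrow> A \<odot> D\<close>. Together with \<open>foldl_interp_Prod\<close> this
  reduces nonempty antecedents to single formulae.\<close>

lemma derivable_foldl_Prod_iff: "derivable H (A # \<Gamma>) B \<longleftrightarrow> derivable H [foldl Prod A \<Gamma>] B"
proof (induction \<Gamma> arbitrary: A)
  case (Cons D \<Gamma>)
  have "derivable H ([A] @ [D]) (A \<odot> D)" by (intro derivable.prodR derivable.ax)
  then have "derivable H (A # D # \<Gamma>) B" if "derivable H (A \<odot> D # \<Gamma>) B"
    using derivable.cut[of H "[A, D]" "A \<odot> D" "[]" \<Gamma> B] that by simp
  moreover have "derivable H (A \<odot> D # \<Gamma>) B" if "derivable H (A # D # \<Gamma>) B"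
    using derivable.prodL[of H "[]" A D \<Gamma> B] that by simp
  ultimately show ?case using Cons[of "A \<odot> D"] by auto
qed simp

lemma true_seq_canonical:
  assumes d: "surj d"
  shows "true_seq UNIV (canon_lang d H) (canon_val d H Bot) (\<lambda>p. canon_val d H (Var p)) (\<Gamma>, B) \<longleftrightarrow>
    derivable H \<Gamma> B"
proof (cases \<Gamma>)
  case Nil
  then show ?thesis by (simp add: interp_canonical[OF d] with_bars_Nil) (simp add: antecedents_def)
next
  case (Cons A \<Delta>)
  \<comment> \<open>The inclusion is tested on \<open>[E]\<close>; the converse is cut.\<close>
  have "antecedents H E \<subseteq> antecedents H B \<longleftrightarrow> derivable H [E] B" for E
    using derivable.cut[of H _ E "[]" "[]" B] derivable.ax[of H E] by (auto simp: antecedents_def)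
  then show ?thesis
    unfolding Cons derivable_foldl_Prod_iff[of H A \<Delta> B] true_seq.simps foldl_interp_Prod
    by (simp only: interp_canonical[OF d] with_bars_subset_iff[OF d])
qed

theorem theorem2:
  fixes H :: "('v :: countable) sequent set" and \<Pi> :: "'v fm list" and C :: "'v fm"
  assumes "\<And>(\<Sigma> :: nat set) L Z v.
    scl_model \<Sigma> L Z v \<Longrightarrow> (\<forall>S\<in>H. true_seq \<Sigma> L Z v S) \<Longrightarrow> true_seq \<Sigma> L Z v (\<Pi>, C)"
  shows "derivable H \<Pi> C"
proof -
  \<comment> \<open>Every number decodes to a letter, so the alphabet is all of \<open>nat\<close>.
    Several codes for one letter would do no harm, since the model depends on decoded words
    only.\<close>
  have d: "surj (from_nat :: nat \<Rightarrow> 'v fm + 'v fm)"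
    by (metis from_nat_to_nat surjI)
  have "\<forall>S\<in>H. true_seq UNIV (canon_lang from_nat H) (canon_val from_nat H Bot)
      (\<lambda>p. canon_val from_nat H (Var p)) S"
    using true_seq_canonical[OF d, of H] derivable.hyp[of _ _ H] by (metis surj_pair)
  then show ?thesis
    using assms[OF scl_model_canonical[OF d]] true_seq_canonical[OF d] by blast
qed

end
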